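(* Let $\mathcal{B}$ and $\mathcal{B}'$ be a pair of RKBSs on $X$ and $X'$ respectively, let $K:X\times X'\to\mathbb{R}$ be the reproducing kernel for $\mathcal{B}$, let $\mathcal{B}_*$ be a pre-dual space of $\mathcal{B}$, let $\nu_1,\dots,\nu_n\in\mathcal{B}_*$ be linearly independent, and put $\mathcal{V}:=\mathrm{span}\{\nu_1,\dots,\nu_n\}$, $\mathcal{L}(f):=[\langle\nu_j,f\rangle_{\mathcal{B}}]_{j=1}^n\in\mathbb{R}^n$ and $\mathcal{M}_{\mathbf{z}}:=\{f\in\mathcal{B}:\mathcal{L}(f)=\mathbf{z}\}$ for $\mathbf{z}\in\mathbb{R}^n$. Let $\mathbf{y}_0\in\mathbb{R}^n$, $\lambda>0$, let $\mathcal{Q}_{\mathbf{y}_0}:\mathbb{R}^n\to\mathbb{R}_+$ be lower semi-continuous and convex, and let $\varphi:\mathbb{R}_+\to\mathbb{R}_+$ be lower semi-continuous, coercive ($\lim_{t\to+\infty}\varphi(t)=+\infty$), convex, differentiable and strictly increasing. Consider the problem $$\inf\{\mathcal{Q}_{\mathbf{y}_0}(\mathcal{L}(f))+\lambda\varphi(\|f\|_{\mathcal{B}}):f\in\mathcal{B}\},\qquad(\mathrm{P})$$ let $\mathrm{R}(\mathbf{y}_0)$ be its solution set and $\mathcal{D}_{\lambda,\mathbf{y}_0}:=\mathcal{L}(\mathrm{R}(\mathbf{y}_0))$. Let $\hat{\mathbf{z}}\in\mathcal{D}_{\lambda,\mathbf{y}_0}\setminus\{\mathbf{0}\}$ and let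 $\hat\nu\in\mathcal{V}$ satisfy $(\|\hat\nu\|_{\mathcal{B}_*}\partial\|\cdot\|_{\mathcal{B}_*}(\hat\nu))\cap\mathcal{M}_{\hat{\mathbf{z}}}\neq\emptyset$. Suppose that Assumption (A1) holds and that Assumption (A2) holds with a positive constant $C$; write $X'_{\hat\nu}=\{x_1',\dots,x'_{n(\hat\nu)}\}$ with $n(\hat\nu)$ the cardinality of $X'_{\hat\nu}$, and $\mathbf{L}_{\hat\nu}:=[\langle\nu_i,K(\cdot,x_j')\rangle_{\mathcal{B}}]\in\mathbb{R}^{n\times n(\hat\nu)}$. Let $l\in\{1,\dots,n(\hat\nu)\}$, let $1\le k_1<\dots<k_l\le n(\hat\nu)$, let $\hat\alpha_{k_i}\in\mathbb{R}\setminus\{0\}$ for $i=1,\dots,l$, and put $\hat{\boldsymbol{\alpha}}:=\sum_{i=1}^l\hat\alpha_{k_i}\mathbf{e}_{k_i}\in\mathbb{R}^{n(\hat\nu)}$. Then $\hat f=\sum_{i=1}^l\hat\alpha_{k_i}K(\cdot,x'_{k_i})$ is a solution of $(\mathrm{P})$ if and only if there exists $\mathbf{a}\in\partial\mathcal{Q}_{\mathbf{y}_0}(\mathbf{L}_{\hat\nu}\hat{\boldsymbol{\alpha}})$ such that $$\lambda=-\frac{(\mathbf{L}_{\hat\nu}^\top\mathbf{a})_{k_i}\,\mathrm{sign}(\hat\alpha_{k_i})}{C\varphi'(C\|\hat{\boldsymbol{\alpha}}\|_1)},\quad i=1,\dots,l,$$ $$\lambda\ge\frac{|(\mathbf{L}_{\hat\nu}^\top\mathbf{a})_j|}{C\varphi'(C\|\hat{\boldsymbol{\alpha}}\|_1)},\quad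 j\in\{1,\dots,n(\hat\nu)\}\setminus\{k_1,\dots,k_l\}.$$
   Context: All spaces are real; $\mathbb{R}_+=[0,+\infty)$; $\mathbf{e}_j$ is the $j$-th standard unit vector. A Banach space of functions on a set $X$ is a Banach space whose elements are functions on $X$ such that $\|f\|=0$ implies $f(x)=0$ for all $x\in X$. It is an RKBS (reproducing kernel Banach space) on $X$ if every point evaluation $\delta_x$, $x\in X$, is continuous. The $\delta$-dual space $\mathcal{B}'$ of an RKBS $\mathcal{B}$ is the norm closure of $\mathrm{span}\{\delta_x:x\in X\}$ in $\mathcal{B}^*$; it is assumed isometrically isomorphic to a Banach space of functions on a set $X'$ and is identified with that space. The reproducing kernel for $\mathcal{B}$ is the unique function $K:X\times X'\to\mathbb{R}$ with $K(x,\cdot)\in\mathcal{B}'$ and $f(x)=\langle K(x,\cdot),f\rangle_{\mathcal{B}}$ for all $x\in X$, $f\in\mathcal{B}$. If moreover $\mathcal{B}'$ is an RKBS on $X'$, $K(\cdot,x')\in\mathcal{B}$ for all $x'\in X'$, and $g(x')=\langle g,K(\cdot,x')\rangle_{\mathcal{B}}$ for all $g\in\mathcal{B}'$, $x'\in X'$, then $\mathcal{B}'$ is called an adjoint RKBS of $\mathcal{B}$, and $\mathcal{B},\mathcal{B}'$ a pair of RKBSs. A pre-dual space of $\mathcal{B}$ is a Banach space $\mathcal{B}_*$ with $(\mathcal{B}_* )^*=\mathcal{B}$ (isometric identification); elements of $\mathcal{B}_*$ act on $\mathcal{B}$ by $\langle\nu,f\rangle_{\mathcal{B}}=\langle f,\nu\rangle_{\mathcal{B}_*}$.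 $\partial$ denotes the convex subdifferential; in particular $\partial\|\cdot\|_{\mathcal{B}_*}(\nu)\subset\mathcal{B}$. $\mathrm{ext}(A)$ is the set of extreme points of a convex set $A$. Assumption (A1): for every nonzero $\nu\in\mathcal{V}$ there exists a finite subset $X'_\nu$ of $X'$ (fixed once and for all) such that $\mathrm{ext}(\partial\|\cdot\|_{\mathcal{B}_*}(\nu))\subset\{-K(\cdot,x'),K(\cdot,x'):x'\in X'_\nu\}$. Assumption (A2): there is a constant $C>0$ such that for all $m\in\mathbb{N}$, all distinct $x_1',\dots,x_m'\in X'$ and all $\boldsymbol{\alpha}\in\mathbb{R}^m$, $\bigl\|\sum_{j=1}^m\alpha_jK(\cdot,x_j')\bigr\|_{\mathcal{B}}=C\|\boldsymbol{\alpha}\|_1$. (The hypothesis on $\hat\nu$ together with $\hat{\mathbf{z}}\ne\mathbf{0}$ forces $\hat\nu\neq0$.) *)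

theory Defs
  imports "HOL-Analysis.Analysis"
begin

section \<open>Reproducing kernel Banach spaces\<close>

text \<open>
  A Banach space of functions on a set \<open>X\<close> is a type \<open>'b\<close> of class \<^class>\<open>banach\<close> together with a
  linear map \<open>ev\<close> sending each element to a function; \<open>ev f x\<close> is the value \<open>f(x)\<close>. Only values at
  points of \<open>X\<close> are meaningful. Elements are functions on \<open>X\<close>, so an element vanishing on \<open>X\<close> is
  zero. The requirement that norm zero forces all values to vanish is contained in linearity.
\<close>

definition banach_function_space :: "'x set \<Rightarrow> ('b::banach \<Rightarrow> 'x \<Rightarrow> real) \<Rightarrow> bool" where
  "banach_function_space X ev \<longleftrightarrow>
     (\<forall>x\<in>X. linear (\<lambda>f. ev f x)) \<and> (\<forall>f. (\<forall>x\<in>X. ev f x = 0) \<longrightarrow> f = 0)"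

definition rkbs :: "'x set \<Rightarrow> ('b::banach \<Rightarrow> 'x \<Rightarrow> real) \<Rightarrow> bool" where
  "rkbs X ev \<longleftrightarrow> banach_function_space X ev \<and> (\<forall>x\<in>X. bounded_linear (\<lambda>f. ev f x))"

definition point_eval :: "('b::banach \<Rightarrow> 'x \<Rightarrow> real) \<Rightarrow> 'x \<Rightarrow> 'b \<Rightarrow>\<^sub>L real" where
  "point_eval ev x = Blinfun (\<lambda>f. ev f x)"

definition delta_dual :: "'x set \<Rightarrow> ('b::banach \<Rightarrow> 'x \<Rightarrow> real) \<Rightarrow> ('b \<Rightarrow>\<^sub>L real) set" where
  "delta_dual X ev = closure (span (point_eval ev ` X))"

definition isometric_iso_onto ::
  "('u::real_normed_vector \<Rightarrow> 'v::real_normed_vector) \<Rightarrow> 'v set \<Rightarrow> bool" where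
  "isometric_iso_onto T S \<longleftrightarrow> linear T \<and> (\<forall>u. norm (T u) = norm u) \<and> range T = S"

text \<open>
  Below, the function space identified with the delta-dual is a type \<open>'c\<close> with evaluation \<open>ev'\<close>, and
  \<open>\<Phi> :: 'c \<Rightarrow> 'b \<Rightarrow>\<^sub>L real\<close> is the identifying isometry, so that \<open>\<Phi> g f\<close> is the pairing of \<open>g\<close>
  with \<open>f\<close>.
\<close>

definition delta_dual_repr ::
  "'x set \<Rightarrow> ('b::banach \<Rightarrow> 'x \<Rightarrow> real) \<Rightarrow> 'y set \<Rightarrow> ('c::banach \<Rightarrow> 'y \<Rightarrow> real)
     \<Rightarrow> ('c \<Rightarrow> 'b \<Rightarrow>\<^sub>L real) \<Rightarrow> bool" where
  "delta_dual_repr X ev X' ev' \<Phi> \<longleftrightarrow>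
     banach_function_space X' ev' \<and> isometric_iso_onto \<Phi> (delta_dual X ev)"

text \<open>Only the values of \<open>K\<close> on \<open>X \<times> X'\<close> matter, and they are uniquely determined by this predicate.\<close>

definition reproducing_kernel ::
  "'x set \<Rightarrow> ('b::banach \<Rightarrow> 'x \<Rightarrow> real) \<Rightarrow> 'y set \<Rightarrow> ('c::banach \<Rightarrow> 'y \<Rightarrow> real)
     \<Rightarrow> ('c \<Rightarrow> 'b \<Rightarrow>\<^sub>L real) \<Rightarrow> ('x \<Rightarrow> 'y \<Rightarrow> real) \<Rightarrow> bool" where
  "reproducing_kernel X ev X' ev' \<Phi> K \<longleftrightarrow>
     (\<forall>x\<in>X. \<exists>g. (\<forall>x'\<in>X'. ev' g x' = K x x') \<and> (\<forall>f. ev f x = blinfun_apply (\<Phi> g) f))"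

definition adjoint_rkbs ::
  "'x set \<Rightarrow> ('b::banach \<Rightarrow> 'x \<Rightarrow> real) \<Rightarrow> 'y set \<Rightarrow> ('c::banach \<Rightarrow> 'y \<Rightarrow> real)
     \<Rightarrow> ('c \<Rightarrow> 'b \<Rightarrow>\<^sub>L real) \<Rightarrow> ('x \<Rightarrow> 'y \<Rightarrow> real) \<Rightarrow> bool" where
  "adjoint_rkbs X ev X' ev' \<Phi> K \<longleftrightarrow>
     rkbs X' ev' \<and>
     (\<forall>x'\<in>X'. \<exists>h. (\<forall>x\<in>X. ev h x = K x x') \<and> (\<forall>g. ev' g x' = blinfun_apply (\<Phi> g) h))"

definition rkbs_pair ::
  "'x set \<Rightarrow> ('b::banach \<Rightarrow> 'x \<Rightarrow> real) \<Rightarrow> 'y set \<Rightarrow> ('c::banach \<Rightarrow> 'y \<Rightarrow> real)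
     \<Rightarrow> ('c \<Rightarrow> 'b \<Rightarrow>\<^sub>L real) \<Rightarrow> ('x \<Rightarrow> 'y \<Rightarrow> real) \<Rightarrow> bool" where
  "rkbs_pair X ev X' ev' \<Phi> K \<longleftrightarrow>
     rkbs X ev \<and> delta_dual_repr X ev X' ev' \<Phi> \<and>
     reproducing_kernel X ev X' ev' \<Phi> K \<and> adjoint_rkbs X ev X' ev' \<Phi> K"

text \<open>
  The element of the space that is the function \<open>K(\<cdot>,x')\<close>. For an RKBS pair it exists for
  \<open>x' \<in> X'\<close>, and it is unique because elements are determined by their values on \<open>X\<close>.
\<close>

definition kernel_section ::
  "'x set \<Rightarrow> ('b::banach \<Rightarrow> 'x \<Rightarrow> real) \<Rightarrow> ('x \<Rightarrow> 'y \<Rightarrow> real) \<Rightarrow> 'y \<Rightarrow> 'b" where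
  "kernel_section X ev K x' = (THE h. \<forall>x\<in>X. ev h x = K x x')"

text \<open>
  \<open>J\<close> identifies \<open>'b\<close> isometrically with the dual of \<open>'p\<close>; the pairing of \<open>\<nu> :: 'p\<close> with
  \<open>f :: 'b\<close> is \<open>J f \<nu>\<close>.
\<close>

definition predual :: "('b::banach \<Rightarrow> 'p::banach \<Rightarrow>\<^sub>L real) \<Rightarrow> bool" where
  "predual J \<longleftrightarrow> isometric_iso_onto J UNIV"


section \<open>Convex analysis\<close>

definition lsc_on :: "'u::topological_space set \<Rightarrow> ('u \<Rightarrow> real) \<Rightarrow> bool" where
  "lsc_on S F \<longleftrightarrow> (\<forall>u\<in>S. \<forall>r<F u. \<forall>\<^sub>F v in at u within S. r < F v)"

definition subdifferential ::
  "('u::real_normed_vector \<Rightarrow> real) \<Rightarrow> 'u \<Rightarrow> ('u \<Rightarrow>\<^sub>L real) set" where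
  "subdifferential F u = {p. \<forall>v. F v \<ge> F u + blinfun_apply p (v - u)}"

text \<open>The subdifferential in Euclidean space, with functionals identified with vectors.\<close>

definition subdifferential_vec :: "('u::real_inner \<Rightarrow> real) \<Rightarrow> 'u \<Rightarrow> 'u set" where
  "subdifferential_vec F u = {a. blinfun_inner_right a \<in> subdifferential F u}"

text \<open>The subdifferential of the norm of the pre-dual, regarded as a subset of \<open>'b\<close> through \<open>J\<close>.\<close>

definition predual_norm_subdiff :: "('b::banach \<Rightarrow> 'p::banach \<Rightarrow>\<^sub>L real) \<Rightarrow> 'p \<Rightarrow> 'b set" where
  "predual_norm_subdiff J \<nu> = {f. J f \<in> subdifferential norm \<nu>}"


section \<open>The regularization problem\<close>

definition measurement ::
  "('b::banach \<Rightarrow> 'p::banach \<Rightarrow>\<^sub>L real) \<Rightarrow> ('n::finite \<Rightarrow> 'p) \<Rightarrow> 'b \<Rightarrow> real^'n" where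
  "measurement J \<nu> f = (\<chi> j. blinfun_apply (J f) (\<nu> j))"

definition interpolants ::
  "('b::banach \<Rightarrow> 'p::banach \<Rightarrow>\<^sub>L real) \<Rightarrow> ('n::finite \<Rightarrow> 'p) \<Rightarrow> real^'n \<Rightarrow> 'b set" where
  "interpolants J \<nu> z = {f. measurement J \<nu> f = z}"

definition reg_objective ::
  "('b::banach \<Rightarrow> 'p::banach \<Rightarrow>\<^sub>L real) \<Rightarrow> ('n::finite \<Rightarrow> 'p) \<Rightarrow> (real^'n \<Rightarrow> real) \<Rightarrow> real
     \<Rightarrow> (real \<Rightarrow> real) \<Rightarrow> 'b \<Rightarrow> real" where
  "reg_objective J \<nu> Q lam \<phi> f = Q (measurement J \<nu> f) + lam * \<phi> (norm f)"

definition reg_solutions ::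
  "('b::banach \<Rightarrow> 'p::banach \<Rightarrow>\<^sub>L real) \<Rightarrow> ('n::finite \<Rightarrow> 'p) \<Rightarrow> (real^'n \<Rightarrow> real) \<Rightarrow> real
     \<Rightarrow> (real \<Rightarrow> real) \<Rightarrow> 'b set" where
  "reg_solutions J \<nu> Q lam \<phi> =
     {f. \<forall>g. reg_objective J \<nu> Q lam \<phi> f \<le> reg_objective J \<nu> Q lam \<phi> g}"


section \<open>The two assumptions on the kernel\<close>

text \<open>\<open>XF \<nu>\<close> is the chosen finite subset of \<open>X'\<close> attached to a nonzero \<open>\<nu>\<close> in the subspace \<open>V\<close>.\<close>

definition assumption_A1 ::
  "'x set \<Rightarrow> ('b::banach \<Rightarrow> 'x \<Rightarrow> real) \<Rightarrow> 'y set \<Rightarrow> ('x \<Rightarrow> 'y \<Rightarrow> real)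
     \<Rightarrow> ('b \<Rightarrow> 'p::banach \<Rightarrow>\<^sub>L real) \<Rightarrow> 'p set \<Rightarrow> ('p \<Rightarrow> 'y set) \<Rightarrow> bool" where
  "assumption_A1 X ev X' K J V XF \<longleftrightarrow>
     (\<forall>\<nu>\<in>V. \<nu> \<noteq> 0 \<longrightarrow>
        finite (XF \<nu>) \<and> XF \<nu> \<subseteq> X' \<and>
        {f. f extreme_point_of predual_norm_subdiff J \<nu>}
          \<subseteq> (\<Union>x'\<in>XF \<nu>. {- kernel_section X ev K x', kernel_section X ev K x'}))"

definition assumption_A2 ::
  "'x set \<Rightarrow> ('b::banach \<Rightarrow> 'x \<Rightarrow> real) \<Rightarrow> 'y set \<Rightarrow> ('x \<Rightarrow> 'y \<Rightarrow> real) \<Rightarrow> real \<Rightarrow> bool" where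
  "assumption_A2 X ev X' K C \<longleftrightarrow>
     C > 0 \<and>
     (\<forall>m (x'::nat \<Rightarrow> 'y) (\<alpha>::nat \<Rightarrow> real).
        inj_on x' {1..m} \<and> x' ` {1..m} \<subseteq> X' \<longrightarrow>
        norm (\<Sum>j=1..m. \<alpha> j *\<^sub>R kernel_section X ev K (x' j)) = C * (\<Sum>j=1..m. \<bar>\<alpha> j\<bar>))"


section \<open>Matrices with \<open>n\<close> rows and \<open>N\<close> columns\<close>

text \<open>
  The number of columns is the cardinality of a set, hence a term rather than a type: columns are
  indexed by \<open>{1..N}\<close>, a matrix is \<open>A :: 'n \<Rightarrow> nat \<Rightarrow> real\<close>, and a vector of length \<open>N\<close> is a
  function on \<open>nat\<close> of which only the entries in \<open>{1..N}\<close> are used.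
\<close>

definition kernel_matrix ::
  "'x set \<Rightarrow> ('b::banach \<Rightarrow> 'x \<Rightarrow> real) \<Rightarrow> ('x \<Rightarrow> 'y \<Rightarrow> real)
     \<Rightarrow> ('b \<Rightarrow> 'p::banach \<Rightarrow>\<^sub>L real) \<Rightarrow> ('n \<Rightarrow> 'p) \<Rightarrow> (nat \<Rightarrow> 'y) \<Rightarrow> 'n \<Rightarrow> nat \<Rightarrow> real" where
  "kernel_matrix X ev K J \<nu> x' i j = blinfun_apply (J (kernel_section X ev K (x' j))) (\<nu> i)"

definition mat_vec :: "nat \<Rightarrow> ('n::finite \<Rightarrow> nat \<Rightarrow> real) \<Rightarrow> (nat \<Rightarrow> real) \<Rightarrow> real^'n" where
  "mat_vec N A \<alpha> = (\<chi> i. \<Sum>j=1..N. A i j * \<alpha> j)"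

definition transpose_vec :: "('n::finite \<Rightarrow> nat \<Rightarrow> real) \<Rightarrow> real^'n \<Rightarrow> nat \<Rightarrow> real" where
  "transpose_vec A a j = (\<Sum>i\<in>UNIV. A i j * a $ i)"

definition l1_norm :: "nat \<Rightarrow> (nat \<Rightarrow> real) \<Rightarrow> real" where
  "l1_norm N \<alpha> = (\<Sum>j=1..N. \<bar>\<alpha> j\<bar>)"

definition unit_vec :: "nat \<Rightarrow> nat \<Rightarrow> real" where
  "unit_vec k = (\<lambda>j. if j = k then 1 else 0)"

end

theory Submission
  imports Defs
begin

text \<open>
  By the first assumption only finitely many kernel sections matter, and by the second the
  coefficients with respect to them see the norm as a multiple of the \<open>\<ell>\<^sup>1\<close> norm. The problem
  therefore has the same optimality conditions as a finite-dimensional \<open>\<ell>\<^sup>1\<close>-regularized one, once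
  two points are settled.

  First, some solution is a combination of the sections attached to \<open>\<nu>h\<close>; otherwise being
  optimal among such combinations would say nothing about the whole space. An element of the
  subdifferential of the norm at \<open>\<nu>h\<close>, scaled by the norm of \<open>\<nu>h\<close>, is an interpolant of least
  norm, because \<open>\<nu>h\<close> is a combination of the measurement functionals and so takes the same value
  on all interpolants of the same data. The subdifferential is convex and weak* compact. If the
  measurement of one of its elements were not a convex combination of measurements of its extreme
  points, a hyperplane in \<open>\<real>\<^sup>n\<close> would separate the two, and pulling that hyperplane back would
  produce a weak* continuous functional whose minimum on the subdifferential is attained at no
  extreme point. This contradicts Bauer's minimum principle (\<open>minimum_at_extreme_point\<close>). So a
  convex combination of extreme points, hence of signed kernel sections, has the same
  measurements and no larger norm (\<open>solution_in_hull_of_extreme_points\<close>). Separating in \<open>\<real>\<^sup>n\<close>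
  spares the density statement of the Krein-Milman theorem.

  Second, optimality has to be turned into conditions on a multiplier \<open>a\<close>. Convexity allows
  \<open>\<phi>\<close> to be replaced by its linearization at the norm of the minimizer
  (\<open>minimiser_linearised\<close>), which leaves a sum of a convex function of the measurements and a
  multiple of the norm. Separating the epigraph of the first summand from the hypograph of the
  second yields \<open>a\<close> (\<open>fenchel_multiplier\<close>). Moving one coefficient at a time
  then gives the equalities on the support and the inequalities off it; conversely these
  conditions are sufficient by convexity (\<open>minimiser_iff_multiplier\<close>).
\<close>

section \<open>Extreme points of pointwise compact convex sets\<close>

lemma face_of_minimisers:
  fixes h :: "'b::real_vector \<Rightarrow> real"
  assumes "convex S" "linear h"
  shows "{f \<in> S. \<forall>g\<in>S. h f \<le> h g} face_of S"
proof -
  interpret linear h by fact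
  let ?T = "{f \<in> S. \<forall>g\<in>S. h f \<le> h g}"
  have "convex ?T"
  proof (rule convexI)
    fix x y and u v :: real
    assume xy: "x \<in> ?T" "y \<in> ?T" and uv: "0 \<le> u" "0 \<le> v" "u + v = 1"
    have "h x = h y" using xy by force
    then have "h (u *\<^sub>R x + v *\<^sub>R y) = h x"
      using uv by (simp add: add scale flip: distrib_right)
    then show "u *\<^sub>R x + v *\<^sub>R y \<in> ?T"
      using xy uv convexD[OF assms(1)] by auto
  qed
  moreover have "a \<in> ?T \<and> b \<in> ?T"
    if ab: "a \<in> S" "b \<in> S" and x: "x \<in> ?T" "x \<in> open_segment a b" for a b x
  proof -
    obtain u where u: "0 < u" "u < 1" "x = (1 - u) *\<^sub>R a + u *\<^sub>R b"
      using x(2) by (auto simp: in_segment)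
    have hx: "h x = (1 - u) * h a + u * h b" by (simp add: u(3) add scale)
    have le: "h x \<le> h a" "h x \<le> h b" using x ab by auto
    have "(1 - u) * (h a - h x) + u * (h b - h x) = 0"
      using hx by (simp add: algebra_simps)
    moreover have "0 \<le> (1 - u) * (h a - h x)" "0 \<le> u * (h b - h x)" using u le by auto
    ultimately have "(1 - u) * (h a - h x) = 0" "u * (h b - h x) = 0" by linarith+
    then have "h a = h x" "h b = h x" using u by auto
    then show ?thesis using x ab by auto
  qed
  ultimately show ?thesis unfolding face_of_def by blast
qed

text \<open>
  The map \<open>e\<close> lists the values of the elements of \<open>S\<close> at all test points, and function spaces
  carry the product topology, so this is relative closedness in the topology of pointwise
  convergence. When \<open>e\<close> is the embedding of a dual space into the functions on the predual, it is
  the relative weak* topology.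
\<close>

definition pointwise_closed_in :: "('b \<Rightarrow> 'p \<Rightarrow> real) \<Rightarrow> 'b set \<Rightarrow> 'b set \<Rightarrow> bool" where
  "pointwise_closed_in e S T \<longleftrightarrow> (\<exists>Z. closed Z \<and> T = {f \<in> S. e f \<in> Z})"

lemma pointwise_closed_in_trans:
  "pointwise_closed_in e S T \<Longrightarrow> pointwise_closed_in e T U \<Longrightarrow> pointwise_closed_in e S U"
  unfolding pointwise_closed_in_def
  by (elim exE conjE, rule_tac x = "Z \<inter> Za" in exI) auto

lemma compact_image_pointwise_closed:
  assumes "compact (e ` S)" "pointwise_closed_in e S T"
  shows "compact (e ` T)"
proof -
  obtain Z where Z: "closed Z" "T = {f \<in> S. e f \<in> Z}"
    using assms(2) by (auto simp: pointwise_closed_in_def)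
  have "e ` T = e ` S \<inter> Z" using Z by auto
  then show ?thesis using assms(1) Z(1) by (simp add: compact_Int_closed)
qed

lemma minimisers_pointwise_closed:
  fixes e :: "'b \<Rightarrow> 'p \<Rightarrow> real"
  assumes "compact (e ` S)" "S \<noteq> {}"
  shows "pointwise_closed_in e S {f \<in> S. \<forall>g\<in>S. e f p \<le> e g p}"
    and "{f \<in> S. \<forall>g\<in>S. e f p \<le> e g p} \<noteq> {}"
proof -
  have cont: "continuous_on A (\<lambda>h::'p \<Rightarrow> real. h p)" for A
    by (rule continuous_on_subset[OF continuous_on_product_coordinates]) simp
  obtain h where h: "h \<in> e ` S" "\<forall>g\<in>e ` S. h p \<le> g p"
    using continuous_attains_inf[OF assms(1) _ cont[of "e ` S"]] assms(2) by auto
  then show "{f \<in> S. \<forall>g\<in>S. e f p \<le> e g p} \<noteq> {}" by blast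
  have "closed {g :: 'p \<Rightarrow> real. g p \<le> h p}"
    by (rule closed_Collect_le[OF cont continuous_on_const])
  moreover have "{f \<in> S. \<forall>g\<in>S. e f p \<le> e g p} = {f \<in> S. e f \<in> {g. g p \<le> h p}}"
    using h by fastforce
  ultimately show "pointwise_closed_in e S {f \<in> S. \<forall>g\<in>S. e f p \<le> e g p}"
    unfolding pointwise_closed_in_def by blast
qed

text \<open>
  Nonempty closed faces satisfy the hypothesis of Zorn's lemma for the reversed inclusion: the
  intersection of a chain is again a closed face, and compactness keeps it nonempty.
\<close>

lemma minimal_closed_face_exists:
  fixes e :: "'b::real_vector \<Rightarrow> 'p \<Rightarrow> real"
  assumes comp: "compact (e ` S)" and "convex S" "S \<noteq> {}"
  obtains T where "T face_of S" "T \<noteq> {}" "pointwise_closed_in e S T"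
    "\<And>U. U face_of S \<Longrightarrow> U \<noteq> {} \<Longrightarrow> pointwise_closed_in e S U \<Longrightarrow> U \<subseteq> T \<Longrightarrow> U = T"
proof -
  define \<F> where "\<F> = {T. T face_of S \<and> T \<noteq> {} \<and> pointwise_closed_in e S T}"
  have "pointwise_closed_in e S S"
    unfolding pointwise_closed_in_def by (rule exI[of _ UNIV]) auto
  then have "S \<in> \<F>"
    using assms by (simp add: \<F>_def face_of_refl)
  \<comment> \<open>Complements turn the search for a minimal face into one for a maximal set.\<close>
  have "\<exists>M\<in>uminus ` \<F>. \<forall>Y\<in>uminus ` \<F>. M \<subseteq> Y \<longrightarrow> Y = M"
  proof (rule subset_Zorn_nonempty)
    show "uminus ` \<F> \<noteq> {}" using \<open>S \<in> \<F>\<close> by blast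
    fix \<C>' assume ne': "\<C>' \<noteq> {}" and ch: "subset.chain (uminus ` \<F>) \<C>'"
    define \<C> where "\<C> = uminus ` \<C>'"
    have ne: "\<C> \<noteq> {}" and eq: "\<Union>\<C>' = - \<Inter>\<C>" using ne' by (auto simp: \<C>_def)
    have sub: "\<C> \<subseteq> \<F>" using ch by (auto simp: \<C>_def subset_chain_def)
    have tot: "T \<subseteq> U \<or> U \<subseteq> T" if "T \<in> \<C>" "U \<in> \<C>" for T U
      using ch that unfolding subset_chain_def \<C>_def by blast
    obtain Z where Z: "\<And>T. T \<in> \<C> \<Longrightarrow> closed (Z T) \<and> T = {f \<in> S. e f \<in> Z T}"
      using sub unfolding \<F>_def pointwise_closed_in_def by (atomize_elim, intro choice) blast
    have "e ` S \<inter> \<Inter>(Z ` \<C>) \<noteq> {}"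
    proof (rule compact_imp_fip[OF comp])
      show "closed W" if "W \<in> Z ` \<C>" for W using that Z by auto
      fix W assume "finite W" "W \<subseteq> Z ` \<C>"
      then obtain D where D: "finite D" "D \<subseteq> \<C>" "W = Z ` D"
        by (meson finite_subset_image)
      show "e ` S \<inter> \<Inter>W \<noteq> {}"
      proof (cases "D = {}")
        case False
        \<comment> \<open>A finite subchain has a least member, and any point of it lies in all the others.\<close>
        have "\<exists>T\<in>D. \<forall>U\<in>D. T \<subseteq> U"
          using D(1) False D(2)
        proof (induction D rule: finite_ne_induct)
          case (insert T D)
          then obtain T' where T': "T' \<in> D" "\<forall>U\<in>D. T' \<subseteq> U" by auto
          show ?case
          proof (cases "T \<subseteq> T'")
            case True
            then have "\<forall>U\<in>insert T D. T \<subseteq> U" using T'(2) by blast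
            then show ?thesis by blast
          next
            case False
            then have "T' \<subseteq> T" using tot[of T T'] insert.prems T'(1) by auto
            then have "\<forall>U\<in>insert T D. T' \<subseteq> U" using T'(2) by blast
            then show ?thesis using T'(1) by blast
          qed
        qed auto
        then obtain T where T: "T \<in> D" "\<forall>U\<in>D. T \<subseteq> U" by blast
        then obtain f where "f \<in> T" using D(2) sub unfolding \<F>_def by blast
        then have "f \<in> S" "\<forall>U\<in>D. e f \<in> Z U" using T D(2) Z by blast+
        then show ?thesis using D(3) by blast
      qed (use D \<open>S \<noteq> {}\<close> in auto)
    qed
    then obtain f where f: "f \<in> S" "\<forall>T\<in>\<C>. e f \<in> Z T" by blast
    have int: "\<Inter>\<C> = {g \<in> S. e g \<in> \<Inter>(Z ` \<C>)}" using Z ne by blast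
    have "closed (\<Inter>(Z ` \<C>))" using Z by (intro closed_Inter) auto
    then have "pointwise_closed_in e S (\<Inter>\<C>)" unfolding pointwise_closed_in_def using int by blast
    moreover have "\<Inter>\<C> \<noteq> {}" using f int by blast
    moreover have "\<Inter>\<C> face_of S" using sub ne by (intro face_of_Inter) (auto simp: \<F>_def)
    ultimately have "\<Inter>\<C> \<in> \<F>" by (simp add: \<F>_def)
    then show "\<Union>\<C>' \<in> uminus ` \<F>" unfolding eq by blast
  qed
  then obtain T where "T \<in> \<F>" and T: "\<And>U. U \<in> \<F> \<Longrightarrow> U \<subseteq> T \<Longrightarrow> U = T" by auto
  then show thesis using that[of T] unfolding \<F>_def by blast
qed

text \<open>
  A minimal closed face is a single point: were some coordinate not constant on it, the set where
  that coordinate is smallest would be a smaller closed face.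
\<close>

lemma extreme_point_exists:
  fixes e :: "'b::real_vector \<Rightarrow> 'p \<Rightarrow> real"
  assumes comp: "compact (e ` S)" and "convex S" "S \<noteq> {}"
    and lin: "\<And>p. linear (\<lambda>f. e f p)" and inj: "inj e"
  shows "\<exists>x. x extreme_point_of S"
proof -
  obtain T where T: "T face_of S" "T \<noteq> {}" "pointwise_closed_in e S T"
    and min: "\<And>U. U face_of S \<Longrightarrow> U \<noteq> {} \<Longrightarrow> pointwise_closed_in e S U \<Longrightarrow> U \<subseteq> T \<Longrightarrow> U = T"
    using minimal_closed_face_exists[OF assms(1-3)] by metis
  have compT: "compact (e ` T)" by (rule compact_image_pointwise_closed[OF comp T(3)])
  have const: "{f \<in> T. \<forall>g\<in>T. e f p \<le> e g p} = T" for p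
  proof (rule min)
    show "{f \<in> T. \<forall>g\<in>T. e f p \<le> e g p} face_of S"
      using face_of_trans[OF face_of_minimisers[OF face_of_imp_convex lin] T(1)] T(1) by blast
    show "{f \<in> T. \<forall>g\<in>T. e f p \<le> e g p} \<noteq> {}"
      by (rule minimisers_pointwise_closed(2)[OF compT T(2)])
    show "pointwise_closed_in e S {f \<in> T. \<forall>g\<in>T. e f p \<le> e g p}"
      by (rule pointwise_closed_in_trans[OF T(3) minimisers_pointwise_closed(1)[OF compT T(2)]])
  qed auto
  obtain x where "x \<in> T" using T(2) by blast
  have "y = x" if "y \<in> T" for y
  proof -
    have "e y p = e x p" for p
      using const[of p] that \<open>x \<in> T\<close> by (intro antisym) blast+
    then show ?thesis using injD[OF inj] by blast
  qed
  then have "T = {x}" using \<open>x \<in> T\<close> by blast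
  then show ?thesis using T(1) face_of_singleton by blast
qed

text \<open>
  Bauer's minimum principle for the coordinate \<open>p\<close>: its minimizers form a closed face, and an
  extreme point of a face is an extreme point of the whole set.
\<close>

lemma minimum_at_extreme_point:
  fixes e :: "'b::real_vector \<Rightarrow> 'p \<Rightarrow> real"
  assumes comp: "compact (e ` S)" and "convex S" "S \<noteq> {}"
    and lin: "\<And>p. linear (\<lambda>f. e f p)" and inj: "inj e"
  obtains x where "x extreme_point_of S" "\<And>y. y \<in> S \<Longrightarrow> e x p \<le> e y p"
proof -
  define T where "T = {f \<in> S. \<forall>g\<in>S. e f p \<le> e g p}"
  have face: "T face_of S" unfolding T_def by (rule face_of_minimisers[OF \<open>convex S\<close> lin])
  have "\<exists>x. x extreme_point_of T"
  proof (rule extreme_point_exists[OF _ face_of_imp_convex[OF face] _ lin inj])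
    show "compact (e ` T)" unfolding T_def
      by (rule compact_image_pointwise_closed[OF comp minimisers_pointwise_closed(1)[OF comp \<open>S \<noteq> {}\<close>]])
    show "T \<noteq> {}" unfolding T_def
      by (rule minimisers_pointwise_closed(2)[OF comp \<open>S \<noteq> {}\<close>])
  qed
  then obtain x where "x extreme_point_of S" "x \<in> T"
    using extreme_point_of_face[OF face] by blast
  then show thesis using that unfolding T_def by blast
qed

section \<open>Optimality conditions for regularized convex problems\<close>

text \<open>
  Minimality of \<open>u\<close> says that in the product of \<open>'z\<close> with the real line the strict epigraph of
  \<open>F - F (L u)\<close> lies above the region below \<open>r u - r\<close>, transported by \<open>L\<close>. A hyperplane between
  these two convex sets cannot be vertical, since \<open>F\<close> is finite everywhere, and its slope is the
  multiplier. This is the sum and chain rule for subdifferentials, with the separation done in the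
  finite-dimensional target of \<open>L\<close>, so that \<open>'v\<close> may be any vector space.
\<close>

lemma fenchel_multiplier:
  fixes L :: "'v::real_vector \<Rightarrow> 'z::euclidean_space" and F :: "'z \<Rightarrow> real"
  assumes L: "linear L" and F: "convex_on UNIV F" and r: "convex_on UNIV r"
    and min: "\<And>v. F (L u) + r u \<le> F (L v) + r v"
  obtains a where "\<And>z. F (L u) + a \<bullet> (z - L u) \<le> F z"
    "\<And>v. r u - r v \<le> a \<bullet> (L v - L u)"
proof -
  interpret linear L by fact
  define A where "A = {(z, t). F z - F (L u) < t}"
  define B where "B = {(L v, t) |v t. t \<le> r u - r v}"
  have "convex A"
  proof (rule convexI)
    fix x y :: "'z \<times> real" and c d :: real
    assume xy: "x \<in> A" "y \<in> A" and cd: "0 \<le> c" "0 \<le> d" "c + d = 1"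
    obtain z s w t where eq: "x = (z, s)" "y = (w, t)" by fastforce
    have "F (c *\<^sub>R z + d *\<^sub>R w) \<le> c * F z + d * F w"
      using F cd by (auto simp: convex_on_def)
    moreover have "c * (F z - F (L u) - s) + d * (F w - F (L u) - t) < 0"
      using xy cd eq by (intro convex_bound_lt) (auto simp: A_def)
    moreover have "c * F (L u) + d * F (L u) = F (L u)"
      using cd by (simp flip: distrib_right)
    ultimately show "c *\<^sub>R x + d *\<^sub>R y \<in> A"
      by (simp add: A_def eq algebra_simps)
  qed
  have "convex B"
  proof (rule convexI)
    fix x y :: "'z \<times> real" and c d :: real
    assume xy: "x \<in> B" "y \<in> B" and cd: "0 \<le> c" "0 \<le> d" "c + d = 1"
    obtain v s w t where eq: "x = (L v, s)" "y = (L w, t)"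
      and st: "s \<le> r u - r v" "t \<le> r u - r w" using xy by (auto simp: B_def)
    have "r (c *\<^sub>R v + d *\<^sub>R w) \<le> c * r v + d * r w"
      using r cd by (auto simp: convex_on_def)
    moreover have "c * (s + r v - r u) + d * (t + r w - r u) \<le> 0"
      using st cd by (intro convex_bound_le) auto
    moreover have "c * r u + d * r u = r u"
      using cd by (simp flip: distrib_right)
    ultimately have "c * s + d * t \<le> r u - r (c *\<^sub>R v + d *\<^sub>R w)"
      by (simp add: algebra_simps)
    then show "c *\<^sub>R x + d *\<^sub>R y \<in> B"
      unfolding B_def eq by (auto simp: add scale intro!: exI[of _ "c *\<^sub>R v + d *\<^sub>R w"])
  qed
  have Au: "(z, F z - F (L u) + t) \<in> A" if "t > 0" for z t using that by (simp add: A_def)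
  have Bv: "(L v, r u - r v) \<in> B" for v by (auto simp: B_def)
  have "B \<inter> A = {}"
    using min by (auto simp: A_def B_def) (smt (verit))
  moreover have "B \<noteq> {}" "A \<noteq> {}" using Bv Au[OF zero_less_one] by blast+
  ultimately obtain q b where q: "q \<noteq> 0" and qB: "\<And>x. x \<in> B \<Longrightarrow> q \<bullet> x \<le> b"
    and qA: "\<And>x. x \<in> A \<Longrightarrow> b \<le> q \<bullet> x"
    using separating_hyperplane_sets[OF \<open>convex B\<close> \<open>convex A\<close>] by metis
  obtain p s where ps: "q = (p, s)" by fastforce
  have B': "p \<bullet> L v + s * (r u - r v) \<le> b" for v
    using qB[OF Bv[of v]] by (simp add: ps)
  have A': "b \<le> p \<bullet> z + s * (F z - F (L u) + t)" if "t > 0" for z t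
    using qA[OF Au[OF that]] by (simp add: ps)
  \<comment> \<open>The epigraph is unbounded upwards, so a negative \<open>s\<close> would push \<open>A\<close> below every bound.\<close>
  have "s \<ge> 0"
  proof (rule ccontr)
    assume "\<not> s \<ge> 0"
    define t where "t = 1 + \<bar>b - p \<bullet> L u\<bar> / (- s)"
    have "t > 0" using \<open>\<not> s \<ge> 0\<close> by (simp add: t_def add_pos_nonneg)
    have "s * t = s - \<bar>b - p \<bullet> L u\<bar>" using \<open>\<not> s \<ge> 0\<close> by (simp add: t_def field_simps)
    then show False using A'[OF \<open>t > 0\<close>, of "L u"] \<open>\<not> s \<ge> 0\<close> by simp
  qed
  moreover have "s \<noteq> 0"
  proof
    assume "s = 0"
    then have "p \<noteq> 0" using q ps by (auto simp: zero_prod_def)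
    have "b \<le> p \<bullet> (L u - p)" "p \<bullet> L u \<le> b"
      using A'[OF zero_less_one] B'[of u] \<open>s = 0\<close> by auto
    moreover have "0 < p \<bullet> p" using \<open>p \<noteq> 0\<close> by simp
    ultimately show False unfolding inner_diff_right by linarith
  qed
  ultimately have "s > 0" by simp
  have A0: "b \<le> p \<bullet> z + s * (F z - F (L u))" for z
  proof (rule field_le_epsilon)
    fix e :: real assume "e > 0"
    then show "b \<le> p \<bullet> z + s * (F z - F (L u)) + e"
      using A'[of "e / s" z] \<open>s > 0\<close> by (simp add: distrib_left)
  qed
  define a where "a = (- 1 / s) *\<^sub>R p"
  have sa: "s * (a \<bullet> (z - w)) = p \<bullet> w - p \<bullet> z" for z w
    using \<open>s > 0\<close> by (simp add: a_def inner_diff_right field_simps)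
  show thesis
  proof
    show "F (L u) + a \<bullet> (z - L u) \<le> F z" for z
    proof -
      have "s * (a \<bullet> (z - L u)) \<le> s * (F z - F (L u))"
        using A0[of z] B'[of u] by (simp add: sa)
      then show ?thesis using \<open>s > 0\<close> by simp
    qed
    show "r u - r v \<le> a \<bullet> (L v - L u)" for v
    proof -
      have "s * (r u - r v) \<le> s * (a \<bullet> (L v - L u))"
        using A0[of "L u"] B'[of v] by (simp add: sa)
      then show ?thesis using \<open>s > 0\<close> by simp
    qed
  qed
qed

text \<open>
  Along the segment from \<open>u\<close> to \<open>v\<close> the objective is at most \<open>(1 - t) * G u + t * G v\<close> plus
  \<open>lam * \<phi> (norm u + t * d)\<close> by convexity and the triangle inequality, with equality at \<open>t = 0\<close>.
  Minimality of \<open>u\<close> makes the derivative of this bound at \<open>0\<close> nonnegative.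
\<close>

lemma minimiser_linearised:
  fixes \<phi> :: "real \<Rightarrow> real" and G :: "'v::real_normed_vector \<Rightarrow> real"
  assumes G: "convex_on UNIV G" and \<phi>: "mono_on {0..} \<phi>" and lam: "lam \<ge> 0"
    and D: "(\<phi> has_real_derivative D) (at (norm u) within {0..})"
    and min: "\<And>v. G u + lam * \<phi> (norm u) \<le> G v + lam * \<phi> (norm v)"
  shows "G u + lam * D * norm u \<le> G v + lam * D * norm v"
proof (rule ccontr)
  assume neg: "\<not> ?thesis"
  define d where "d = norm v - norm u"
  define g where "g t = t * (G v - G u) + lam * \<phi> (norm u + t * d)" for t
  have seg: "norm u + t * d = (1 - t) * norm u + t * norm v" for t
    by (simp add: d_def algebra_simps)
  have "((\<lambda>t. norm u + t * d) has_real_derivative d) (at 0 within {0..1})"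
    by (auto intro!: derivative_eq_intros)
  moreover have "(\<phi> has_real_derivative D) (at (norm u + 0 * d) within (\<lambda>t. norm u + t * d) ` {0..1})"
    by (rule DERIV_subset[of _ _ _ "{0..}"]) (use D in \<open>auto simp: seg\<close>)
  ultimately have "((\<lambda>t. \<phi> (norm u + t * d)) has_real_derivative D * d) (at 0 within {0..1})"
    using DERIV_image_chain[of \<phi> D "\<lambda>t. norm u + t * d" 0 "{0..1}" d] by (simp add: o_def)
  then have "(g has_real_derivative (G v - G u) + lam * (D * d)) (at 0 within {0..1})"
    unfolding g_def by (auto intro!: derivative_eq_intros)
  moreover have "(G v - G u) + lam * (D * d) < 0"
    using neg by (simp add: d_def algebra_simps)
  ultimately obtain h where h: "h > 0" "\<And>t. t > 0 \<Longrightarrow> t \<in> {0..1} \<Longrightarrow> t < h \<Longrightarrow> g t < g 0"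
    using has_real_derivative_neg_dec_right[of g _ 0 "{0..1}"] by auto
  define t where "t = min (1/2) (h/2)"
  have t: "0 < t" "t \<le> 1" "t < h" using h(1) by (auto simp: t_def min_def)
  define w where "w = (1 - t) *\<^sub>R u + t *\<^sub>R v"
  have "G w \<le> (1 - t) * G u + t * G v" unfolding w_def
    using G t by (auto simp: convex_on_def)
  moreover have "norm w \<le> norm u + t * d"
    using norm_triangle_ineq[of "(1 - t) *\<^sub>R u" "t *\<^sub>R v"] t by (simp add: w_def seg)
  then have "\<phi> (norm w) \<le> \<phi> (norm u + t * d)"
    by (intro mono_onD[OF \<phi>]) (auto intro: order_trans[OF norm_ge_zero])
  then have "lam * \<phi> (norm w) \<le> lam * \<phi> (norm u + t * d)" using lam by (rule mult_left_mono)
  moreover have "g t < g 0" using h(2) t by simp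
  ultimately show False using min[of w] by (simp add: g_def algebra_simps)
qed

lemma convex_above_tangent:
  assumes "convex_on {0..} \<phi>" "(\<phi> has_real_derivative D) (at s within {0..})" "s > 0" "t \<ge> 0"
  shows "\<phi> s + D * (t - s) \<le> \<phi> t"
  using convex_on_imp_above_tangent[OF assms(1), of s t D] assms by simp

lemma strict_mono_convex_derivative_pos:
  fixes \<phi> :: "real \<Rightarrow> real"
  assumes "convex_on {0..} \<phi>" "strict_mono_on {0..} \<phi>"
    "(\<phi> has_real_derivative D) (at s within {0..})" "s > 0"
  shows "D > 0"
proof -
  have "\<phi> 0 < \<phi> s" using assms(2,4) by (auto intro: strict_mono_onD)
  then have "0 < D * s" using convex_above_tangent[OF assms(1,3,4), of 0] by simp
  then show ?thesis using assms(4) by (simp add: zero_less_mult_iff)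
qed

section \<open>Minimizers in the span of a family with an l1 norm\<close>

text \<open>
  The hypotheses say that \<open>- b\<close> is a subgradient of \<open>\<lambda>y. \<mu> * \<bar>y\<bar>\<close> at \<open>x\<close>.
\<close>

lemma l1_coordinate_bound:
  fixes \<mu> b x y :: real
  assumes "\<mu> \<ge> 0" "x \<noteq> 0 \<longrightarrow> b * sgn x = - \<mu>" "x = 0 \<longrightarrow> \<bar>b\<bar> \<le> \<mu>"
  shows "0 \<le> b * (y - x) + \<mu> * (\<bar>y\<bar> - \<bar>x\<bar>)"
proof -
  have "\<bar>b\<bar> \<le> \<mu>"
    using assms by (cases "x = 0") (auto simp: sgn_if split: if_splits)
  then have "\<bar>b * y\<bar> \<le> \<mu> * \<bar>y\<bar>" by (simp add: abs_mult mult_right_mono)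
  moreover have "b * x = - (\<mu> * \<bar>x\<bar>)"
    using assms(2) by (cases "x = 0") (auto simp: sgn_if split: if_splits)
  ultimately show ?thesis by (simp add: algebra_simps abs_le_iff)
qed

text \<open>
  The optimality conditions of the theorem, for a family \<open>\<kappa>\<close> on whose span the norm is a multiple
  of the \<open>\<ell>\<^sup>1\<close> norm of the coefficients. The conditions only compare \<open>u\<close> with other elements of this
  span, so sufficiency needs a global minimizer in it; the hypothesis \<open>sol\<close> provides one.
\<close>

lemma minimiser_iff_multiplier:
  fixes \<kappa> :: "'i \<Rightarrow> 'v::real_normed_vector" and L :: "'v \<Rightarrow> 'z::euclidean_space"
    and F :: "'z \<Rightarrow> real" and I :: "'i set" and \<alpha> :: "'i \<Rightarrow> real" and C D lam :: real
  defines "u \<equiv> \<Sum>j\<in>I. \<alpha> j *\<^sub>R \<kappa> j" and "\<mu> \<equiv> lam * D * C"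
  assumes I: "finite I" and L: "linear L" and F: "convex_on UNIV F"
    and norm_sum: "\<And>\<beta>. norm (\<Sum>j\<in>I. \<beta> j *\<^sub>R \<kappa> j) = C * (\<Sum>j\<in>I. \<bar>\<beta> j\<bar>)"
    and C: "C \<ge> 0" and lam: "lam \<ge> 0" and \<phi>: "mono_on {0..} \<phi>" "convex_on {0..} \<phi>"
    and D: "(\<phi> has_real_derivative D) (at (norm u) within {0..})" "D \<ge> 0" and u: "u \<noteq> 0"
    and sol: "\<And>v. F (L (\<Sum>j\<in>I. \<beta> j *\<^sub>R \<kappa> j)) + lam * \<phi> (norm (\<Sum>j\<in>I. \<beta> j *\<^sub>R \<kappa> j))
                  \<le> F (L v) + lam * \<phi> (norm v)"
  shows "(\<forall>v. F (L u) + lam * \<phi> (norm u) \<le> F (L v) + lam * \<phi> (norm v)) \<longleftrightarrow>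
    (\<exists>a. (\<forall>z. F (L u) + a \<bullet> (z - L u) \<le> F z) \<and>
       (\<forall>j\<in>I. (\<alpha> j \<noteq> 0 \<longrightarrow> a \<bullet> L (\<kappa> j) * sgn (\<alpha> j) = - \<mu>) \<and>
               (\<alpha> j = 0 \<longrightarrow> \<bar>a \<bullet> L (\<kappa> j)\<bar> \<le> \<mu>)))" (is "?min \<longleftrightarrow> (\<exists>a. ?cond a)")
proof
  interpret linear L by fact
  assume min: ?min
  have "convex_on UNIV (\<lambda>v. F (L v))"
    using F unfolding convex_on_def by (auto simp: add scale)
  then have lin: "F (L u) + lam * D * norm u \<le> F (L v) + lam * D * norm v" for v
    by (rule minimiser_linearised[OF _ \<phi>(1) lam D(1)]) (use min in auto)
  have "convex_on UNIV (\<lambda>v. lam * D * norm v)"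
    using convex_on_cmul[OF _ convex_on_dist[OF convex_UNIV, of 0], of "lam * D"] lam D(2) by simp
  then obtain a where a: "\<And>z. F (L u) + a \<bullet> (z - L u) \<le> F z"
    and av: "\<And>v. lam * D * norm u - lam * D * norm v \<le> a \<bullet> (L v - L u)"
    using fenchel_multiplier[OF L F _ lin] by metis
  \<comment> \<open>Comparison of \<open>u\<close> with \<open>u + t *\<^sub>R \<kappa> j\<close>, where only one coefficient changes.\<close>
  have shift: "\<mu> * (\<bar>\<alpha> j\<bar> - \<bar>\<alpha> j + t\<bar>) \<le> t * (a \<bullet> L (\<kappa> j))" if "j \<in> I" for j t
  proof -
    have "(\<Sum>i\<in>I. (\<alpha>(j := \<alpha> j + t)) i *\<^sub>R \<kappa> i) = u + t *\<^sub>R \<kappa> j"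
      using I that unfolding u_def
      by (simp add: sum.remove[of I j] scaleR_add_left cong: sum.cong_simp if_cong)
    moreover have "(\<Sum>i\<in>I. \<bar>(\<alpha>(j := \<alpha> j + t)) i\<bar>) = (\<Sum>i\<in>I. \<bar>\<alpha> i\<bar>) + (\<bar>\<alpha> j + t\<bar> - \<bar>\<alpha> j\<bar>)"
      using I that by (simp add: sum.remove[of I j] cong: sum.cong_simp if_cong)
    ultimately have norm_shift: "norm (u + t *\<^sub>R \<kappa> j) = norm u + C * (\<bar>\<alpha> j + t\<bar> - \<bar>\<alpha> j\<bar>)"
      using norm_sum[of "\<alpha>(j := \<alpha> j + t)"] norm_sum[of \<alpha>] by (simp add: u_def distrib_left)
    show ?thesis
      using av[of "u + t *\<^sub>R \<kappa> j"] unfolding norm_shift by (simp add: \<mu>_def add scale algebra_simps)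
  qed
  have "(\<alpha> j \<noteq> 0 \<longrightarrow> a \<bullet> L (\<kappa> j) * sgn (\<alpha> j) = - \<mu>) \<and> (\<alpha> j = 0 \<longrightarrow> \<bar>a \<bullet> L (\<kappa> j)\<bar> \<le> \<mu>)"
    if j: "j \<in> I" for j
  proof (cases "\<alpha> j = 0")
    case True
    then show ?thesis using shift[OF j, of 1] shift[OF j, of "-1"] by simp
  next
    case False
    \<comment> \<open>The shifts by \<open>\<alpha> j\<close> and \<open>- \<alpha> j\<close> double the coefficient and delete it.\<close>
    have "\<alpha> j * (a \<bullet> L (\<kappa> j)) = - (\<mu> * \<bar>\<alpha> j\<bar>)"
      using shift[OF j, of "\<alpha> j"] shift[OF j, of "- \<alpha> j"] by (simp add: abs_mult algebra_simps)
    also have "\<dots> = \<alpha> j * (- \<mu> * sgn (\<alpha> j))" by (simp add: abs_sgn)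
    finally have "a \<bullet> L (\<kappa> j) = - \<mu> * sgn (\<alpha> j)" using False by (metis mult_left_cancel)
    moreover have "sgn (\<alpha> j) * sgn (\<alpha> j) = 1" using False by (simp add: sgn_if)
    ultimately show ?thesis using False by (simp add: mult.assoc)
  qed
  then show "\<exists>a. ?cond a" using a by blast
next
  interpret linear L by fact
  assume "\<exists>a. ?cond a"
  then obtain a where a: "\<And>z. F (L u) + a \<bullet> (z - L u) \<le> F z"
    and aj: "\<And>j. j \<in> I \<Longrightarrow> \<alpha> j \<noteq> 0 \<longrightarrow> a \<bullet> L (\<kappa> j) * sgn (\<alpha> j) = - \<mu>"
      "\<And>j. j \<in> I \<Longrightarrow> \<alpha> j = 0 \<longrightarrow> \<bar>a \<bullet> L (\<kappa> j)\<bar> \<le> \<mu>" by blast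
  have "0 \<le> \<mu>" using lam C D(2) by (simp add: \<mu>_def)
  define w where "w = (\<Sum>j\<in>I. \<beta> j *\<^sub>R \<kappa> j)"
  have "0 \<le> (\<Sum>j\<in>I. a \<bullet> L (\<kappa> j) * (\<beta> j - \<alpha> j) + \<mu> * (\<bar>\<beta> j\<bar> - \<bar>\<alpha> j\<bar>))"
    using \<open>0 \<le> \<mu>\<close> by (intro sum_nonneg l1_coordinate_bound aj)
  also have "\<dots> = a \<bullet> (L w - L u) + lam * (D * (norm w - norm u))"
    unfolding w_def u_def norm_sum \<mu>_def
    by (simp add: sum scale inner_sum_right sum.distrib sum_subtractf algebra_simps
        flip: sum_distrib_left)
  also have "\<dots> \<le> (F (L w) - F (L u)) + lam * (\<phi> (norm w) - \<phi> (norm u))"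
    using a[of "L w"] convex_above_tangent[OF \<phi>(2) D(1), of "norm w"] u lam
    by (intro add_mono mult_left_mono) auto
  finally have "F (L u) + lam * \<phi> (norm u) \<le> F (L w) + lam * \<phi> (norm w)"
    by (simp add: algebra_simps)
  then show ?min using sol unfolding w_def by (meson order_trans)
qed

section \<open>The subdifferential of the norm of the predual\<close>

lemma predual_representation:
  fixes J :: "'b::banach \<Rightarrow> 'p::banach \<Rightarrow>\<^sub>L real"
  assumes "predual J"
  shows "linear J" "norm (J f) = norm f" "surj J" "inj (\<lambda>f. blinfun_apply (J f))"
    "linear (\<lambda>f. blinfun_apply (J f) p)"
proof -
  show J: "linear J" "norm (J f) = norm f" "surj J" for f
    using assms by (auto simp: predual_def isometric_iso_onto_def)
  interpret linear J by fact
  show "linear (\<lambda>f. blinfun_apply (J f) p)"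
    by (rule linearI) (simp_all add: add scale blinfun.add_left blinfun.scaleR_left)
  have "f = g" if "J f = J g" for f g
    using J(2)[of "f - g"] that by (simp add: diff)
  then show "inj (\<lambda>f. blinfun_apply (J f))"
    by (intro injI) (metis blinfun_eqI)
qed

text \<open>
  Testing the subgradient inequality at \<open>\<nu> + p\<close> and at \<open>0\<close> shows that the subgradients of the norm
  are the norming functionals.
\<close>

lemma predual_norm_subdiff_iff:
  fixes J :: "'b::banach \<Rightarrow> 'p::banach \<Rightarrow>\<^sub>L real"
  assumes "predual J"
  shows "f \<in> predual_norm_subdiff J \<nu> \<longleftrightarrow>
    (\<forall>p. blinfun_apply (J f) p \<le> norm p) \<and> blinfun_apply (J f) \<nu> = norm \<nu>" (is "?L \<longleftrightarrow> ?R")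
proof
  assume ?R then show ?L
    by (auto simp: predual_norm_subdiff_def subdifferential_def blinfun.diff_right)
next
  assume ?L
  then have *: "norm v \<ge> norm \<nu> + J f (v - \<nu>)" for v
    by (auto simp: predual_norm_subdiff_def subdifferential_def)
  have a: "J f p \<le> norm p" for p
    using *[of "\<nu> + p"] norm_triangle_ineq[of \<nu> p] by simp
  have "J f \<nu> \<ge> norm \<nu>" using *[of 0] by (simp add: blinfun.diff_right blinfun.minus_right)
  then show ?R using a[of \<nu>] a by (auto intro: antisym)
qed

lemma predual_norm_subdiff_norm_le:
  assumes "predual J" "f \<in> predual_norm_subdiff J \<nu>"
  shows "norm f \<le> 1"
proof -
  have le: "J f p \<le> norm p" for p using assms by (simp add: predual_norm_subdiff_iff)
  have "norm (J f p) \<le> 1 * norm p" for p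
    using le[of p] le[of "- p"] by (simp add: blinfun.minus_right abs_le_iff)
  then have "norm (J f) \<le> 1" by (intro norm_blinfun_bound) auto
  then show ?thesis by (simp add: predual_representation(2)[OF assms(1)])
qed

lemma convex_predual_norm_subdiff:
  assumes "predual J"
  shows "convex (predual_norm_subdiff J \<nu>)"
proof (rule convexI)
  fix f g and u v :: real
  assume fg: "f \<in> predual_norm_subdiff J \<nu>" "g \<in> predual_norm_subdiff J \<nu>"
    and uv: "0 \<le> u" "0 \<le> v" "u + v = 1"
  interpret linear J by (rule predual_representation(1)[OF assms])
  have eq: "J (u *\<^sub>R f + v *\<^sub>R g) p = u * J f p + v * J g p" for p
    by (simp add: add scale blinfun.add_left blinfun.scaleR_left)
  have "u * J f p + v * J g p \<le> norm p" for p
    using fg uv by (intro convex_bound_le) (auto simp: predual_norm_subdiff_iff[OF assms])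
  moreover have "u * J f \<nu> + v * J g \<nu> = norm \<nu>"
    using fg uv by (simp add: predual_norm_subdiff_iff[OF assms] flip: distrib_right)
  ultimately show "u *\<^sub>R f + v *\<^sub>R g \<in> predual_norm_subdiff J \<nu>"
    by (simp add: predual_norm_subdiff_iff[OF assms] eq)
qed

text \<open>
  The Banach-Alaoglu argument: the values of a norming functional lie in a product of compact
  intervals, and linearity and the value at \<open>\<nu>\<close> are closed conditions. A function in the product
  with these properties is a bounded functional, hence represented because \<open>J\<close> is onto.
\<close>

lemma compact_predual_norm_subdiff:
  fixes J :: "'b::banach \<Rightarrow> 'p::banach \<Rightarrow>\<^sub>L real"
  assumes "predual J"
  shows "compact ((\<lambda>f. blinfun_apply (J f)) ` predual_norm_subdiff J \<nu>)"
proof -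
  define P :: "('p \<Rightarrow> real) set" where "P = (\<Pi>\<^sub>E p\<in>UNIV. {- norm p..norm p})"
  have "compact P"
    unfolding P_def using compactin_PiE[of "\<lambda>_. euclidean" UNIV "\<lambda>p::'p. {- norm p..norm p}"]
    by (simp add: euclidean_product_topology)
  have cont: "continuous_on UNIV (\<lambda>h::'p \<Rightarrow> real. h p)" for p by simp
  define Z :: "('p \<Rightarrow> real) set" where
    "Z = (\<Inter>p. \<Inter>q. {h. h (p + q) = h p + h q}) \<inter> (\<Inter>c. \<Inter>p. {h. h (c *\<^sub>R p) = c * h p})
         \<inter> {h. h \<nu> = norm \<nu>}"
  have "closed Z" unfolding Z_def
    by (intro closed_Int closed_INT ballI closed_Collect_eq continuous_on_add continuous_on_mult
        continuous_on_const continuous_on_product_coordinates)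
  have "(\<lambda>f. blinfun_apply (J f)) ` predual_norm_subdiff J \<nu> = P \<inter> Z"
  proof (intro equalityI subsetI)
    fix h assume "h \<in> (\<lambda>f. blinfun_apply (J f)) ` predual_norm_subdiff J \<nu>"
    then obtain f where f: "h = J f" "\<And>p. J f p \<le> norm p" "J f \<nu> = norm \<nu>"
      by (auto simp: predual_norm_subdiff_iff[OF assms])
    have "- norm p \<le> J f p" for p using f(2)[of "- p"] by (simp add: blinfun.minus_right)
    then show "h \<in> P \<inter> Z"
      using f by (auto simp: P_def Z_def blinfun.add_right blinfun.scaleR_right)
  next
    fix h assume h: "h \<in> P \<inter> Z"
    then have bound: "\<bar>h p\<bar> \<le> norm p" for p 
      using PiE_mem[of h UNIV "\<lambda>p. {- norm p..norm p}" p] by (auto simp: P_def)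
    have "bounded_linear h"
      using h bound by (intro bounded_linear_intro[where K = 1]) (auto simp: Z_def)
    then have app: "blinfun_apply (Blinfun h) = h" by (rule bounded_linear_Blinfun_apply)
    obtain f where f: "J f = Blinfun h"
      using predual_representation(3)[OF assms] by (metis surj_def)
    have "f \<in> predual_norm_subdiff J \<nu>"
      using h bound by (auto simp: predual_norm_subdiff_iff[OF assms] f app Z_def abs_le_iff)
    then show "h \<in> (\<lambda>f. blinfun_apply (J f)) ` predual_norm_subdiff J \<nu>"
      using f app by (intro image_eqI[of _ _ f]) auto
  qed
  then show ?thesis using \<open>compact P\<close> \<open>closed Z\<close> by (simp add: compact_Int_closed)
qed

lemma linear_measurement:
  assumes "predual J"
  shows "linear (measurement J \<nu>)"
proof (rule linearI)
  interpret linear J by (rule predual_representation(1)[OF assms])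
  show "measurement J \<nu> (f + g) = measurement J \<nu> f + measurement J \<nu> g" for f g
    by (simp add: measurement_def vec_eq_iff add blinfun.add_left)
  show "measurement J \<nu> (c *\<^sub>R f) = c *\<^sub>R measurement J \<nu> f" for c f
    by (simp add: measurement_def vec_eq_iff scale blinfun.scaleR_left)
qed

lemma inner_measurement:
  "a \<bullet> measurement J \<nu> f = blinfun_apply (J f) (\<Sum>i\<in>UNIV. a $ i *\<^sub>R \<nu> i)"
  by (simp add: measurement_def inner_vec_def blinfun.sum_right blinfun.scaleR_right)

text \<open>
  A linear functional on \<open>\<real>\<^sup>n\<close> composed with the measurement map is evaluation at a point of the
  predual (\<open>inner_measurement\<close>), so its minimum over the subdifferential is attained at an extreme
  point. Hence no hyperplane separates the measurement of \<open>f\<close> from those of the extreme points.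
  Finiteness of \<open>E\<close> makes the convex hull closed.
\<close>

lemma measurement_in_hull_of_extreme_points:
  fixes J :: "'b::banach \<Rightarrow> 'p::banach \<Rightarrow>\<^sub>L real" and \<nu> :: "'n::finite \<Rightarrow> 'p"
  assumes J: "predual J" and f: "f \<in> predual_norm_subdiff J \<mu>"
    and E: "finite E" "{g. g extreme_point_of predual_norm_subdiff J \<mu>} \<subseteq> E"
  obtains g where "g \<in> convex hull {g. g extreme_point_of predual_norm_subdiff J \<mu>}"
    "measurement J \<nu> g = measurement J \<nu> f"
proof -
  let ?S = "predual_norm_subdiff J \<mu>"
  let ?E = "{g. g extreme_point_of ?S}"
  let ?H = "convex hull (measurement J \<nu> ` ?E)"
  have "measurement J \<nu> f \<in> ?H"
  proof (rule ccontr)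
    assume "measurement J \<nu> f \<notin> ?H"
    moreover have "closed ?H"
      using E by (intro compact_imp_closed finite_imp_compact_convex_hull) (auto intro: finite_subset)
    ultimately obtain a b where ab: "a \<bullet> measurement J \<nu> f < b" "\<And>z. z \<in> ?H \<Longrightarrow> b < a \<bullet> z"
      using separating_hyperplane_closed_point[of ?H] convex_convex_hull by blast
    obtain g where g: "g extreme_point_of ?S"
      "\<And>h. h \<in> ?S \<Longrightarrow> J g (\<Sum>i\<in>UNIV. a $ i *\<^sub>R \<nu> i) \<le> J h (\<Sum>i\<in>UNIV. a $ i *\<^sub>R \<nu> i)"
      using minimum_at_extreme_point[OF compact_predual_norm_subdiff[OF J]
          convex_predual_norm_subdiff[OF J] _ predual_representation(5,4)[OF J]] f by blast
    then have "a \<bullet> measurement J \<nu> g \<le> a \<bullet> measurement J \<nu> f"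
      using f by (simp add: inner_measurement)
    moreover have "measurement J \<nu> g \<in> ?H" using g(1) by (auto intro: hull_inc)
    ultimately show False using ab(1) ab(2)[of "measurement J \<nu> g"] by linarith
  qed
  then have "measurement J \<nu> f \<in> measurement J \<nu> ` (convex hull ?E)"
    by (simp add: convex_hull_linear_image[OF linear_measurement[OF J]])
  then show thesis using that by (metis imageE)
qed

section \<open>Solutions spanned by finitely many kernel sections\<close>

text \<open>
  Since \<open>\<mu>\<close> lies in the span of the measurement functionals, \<open>h\<close> and \<open>norm \<mu> *\<^sub>R f\<close> agree on it,
  with value the square of its norm, so \<open>h\<close> has norm at least that of \<open>\<mu>\<close>. An element of the
  subdifferential has norm at most one, whence the scaled one does at least as well as \<open>h\<close>.
\<close>

lemma solution_in_hull_of_extreme_points: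
  fixes J :: "'b::banach \<Rightarrow> 'p::banach \<Rightarrow>\<^sub>L real" and \<nu> :: "'n::finite \<Rightarrow> 'p"
  assumes J: "predual J" and lam: "lam \<ge> 0" and \<phi>: "mono_on {0..} \<phi>"
    and h: "h \<in> reg_solutions J \<nu> Q lam \<phi>" and \<mu>: "\<mu> \<in> span (range \<nu>)"
    and f: "f \<in> predual_norm_subdiff J \<mu>" "measurement J \<nu> (norm \<mu> *\<^sub>R f) = measurement J \<nu> h"
    and E: "finite E" "{g. g extreme_point_of predual_norm_subdiff J \<mu>} \<subseteq> E"
  obtains g where "g \<in> convex hull E" "norm \<mu> *\<^sub>R g \<in> reg_solutions J \<nu> Q lam \<phi>"
proof -
  let ?S = "predual_norm_subdiff J \<mu>"
  obtain g where g: "g \<in> convex hull {g. g extreme_point_of ?S}"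
    "measurement J \<nu> g = measurement J \<nu> f"
    using measurement_in_hull_of_extreme_points[OF J f(1) E] by metis
  have "convex hull {g. g extreme_point_of ?S} \<subseteq> ?S"
    by (intro hull_minimal convex_predual_norm_subdiff[OF J]) (auto simp: extreme_point_of_def)
  then have "norm g \<le> 1" using predual_norm_subdiff_norm_le[OF J] g(1) by blast
  have meas: "measurement J \<nu> (norm \<mu> *\<^sub>R g) = measurement J \<nu> h"
    using f(2) g(2) by (simp add: linear_cmul[OF linear_measurement[OF J]])
  have "blinfun_apply (J h) \<mu> = blinfun_apply (J (norm \<mu> *\<^sub>R f)) \<mu>"
  proof (rule linear_eq_on[of "blinfun_apply (J h)" "blinfun_apply (J (norm \<mu> *\<^sub>R f))", OF _ _ \<mu>])
    show "blinfun_apply (J h) p = blinfun_apply (J (norm \<mu> *\<^sub>R f)) p" if "p \<in> range \<nu>" for p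
      using f(2) that by (auto simp: measurement_def vec_eq_iff)
  qed (auto intro: bounded_linear.linear blinfun.bounded_linear_right)
  also have "\<dots> = norm \<mu> * norm \<mu>"
    using f(1) predual_norm_subdiff_iff[OF J] 
    by (simp add: linear_cmul[OF predual_representation(5)[OF J]])
  finally have "norm \<mu> * norm \<mu> \<le> norm h * norm \<mu>"
    using norm_blinfun[of "J h" \<mu>] by (simp add: predual_representation(2)[OF J])
  then have "norm \<mu> \<le> norm h" by (cases "\<mu> = 0") auto
  moreover have "norm (norm \<mu> *\<^sub>R g) \<le> norm \<mu>" using \<open>norm g \<le> 1\<close> by (simp add: mult_left_le)
  ultimately have "norm (norm \<mu> *\<^sub>R g) \<le> norm h" by linarith
  then have "\<phi> (norm (norm \<mu> *\<^sub>R g)) \<le> \<phi> (norm h)" by (intro mono_onD[OF \<phi>]) auto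
  then have "reg_objective J \<nu> Q lam \<phi> (norm \<mu> *\<^sub>R g) \<le> reg_objective J \<nu> Q lam \<phi> h"
    using lam by (simp add: reg_objective_def meas mult_left_mono del: norm_scaleR)
  then have "norm \<mu> *\<^sub>R g \<in> reg_solutions J \<nu> Q lam \<phi>"
    using h unfolding reg_solutions_def by (auto intro: order_trans)
  moreover have "g \<in> convex hull E" using g(1) hull_mono[OF E(2)] by blast
  ultimately show thesis by (rule that[rotated])
qed

lemma convex_hull_signed_family:
  fixes \<kappa> :: "'i \<Rightarrow> 'v::real_vector"
  assumes I: "finite I" and g: "g \<in> convex hull (\<Union>j\<in>I. {- \<kappa> j, \<kappa> j})"
  obtains \<beta> where "g = (\<Sum>j\<in>I. \<beta> j *\<^sub>R \<kappa> j)"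
proof -
  let ?W = "range (\<lambda>\<beta>. \<Sum>j\<in>I. \<beta> j *\<^sub>R \<kappa> j)"
  have "subspace ?W"
  proof (rule subspaceI)
    show "0 \<in> ?W" by (rule image_eqI[of _ _ "\<lambda>_. 0"]) auto
    fix x y assume "x \<in> ?W" "y \<in> ?W"
    then obtain \<beta> \<gamma> where "x = (\<Sum>j\<in>I. \<beta> j *\<^sub>R \<kappa> j)" "y = (\<Sum>j\<in>I. \<gamma> j *\<^sub>R \<kappa> j)" by blast
    then show "x + y \<in> ?W"
      by (intro image_eqI[of _ _ "\<lambda>j. \<beta> j + \<gamma> j"]) (auto simp: scaleR_add_left sum.distrib)
  next
    fix c x assume "x \<in> ?W"
    then obtain \<beta> where "x = (\<Sum>j\<in>I. \<beta> j *\<^sub>R \<kappa> j)" by blast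
    then show "c *\<^sub>R x \<in> ?W"
      by (intro image_eqI[of _ _ "\<lambda>j. c * \<beta> j"]) (auto simp: scaleR_sum_right)
  qed
  moreover have in_W: "\<kappa> j \<in> ?W" if "j \<in> I" for j
    using I that by (intro image_eqI[of _ _ "\<lambda>i. if i = j then 1 else 0"])
      (auto simp: if_distrib[of "\<lambda>c. c *\<^sub>R _"] cong: if_cong)
  ultimately have "(\<Union>j\<in>I. {- \<kappa> j, \<kappa> j}) \<subseteq> ?W" using subspace_neg by blast
  then have "convex hull (\<Union>j\<in>I. {- \<kappa> j, \<kappa> j}) \<subseteq> ?W"
    by (rule hull_minimal[of _ _ convex]) (rule subspace_imp_convex[OF \<open>subspace ?W\<close>])
  then show thesis using g that by blast
qed

section \<open>Characterization of the sparse solutions\<close>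

lemma subdifferential_vec_iff:
  "a \<in> subdifferential_vec F z \<longleftrightarrow> (\<forall>w. F z + a \<bullet> (w - z) \<le> F w)"
  by (simp add: subdifferential_vec_def subdifferential_def)

theorem theorem15:
  fixes X :: "'x set" and X' :: "'y set"
    and ev :: "'b::banach \<Rightarrow> 'x \<Rightarrow> real" and ev' :: "'c::banach \<Rightarrow> 'y \<Rightarrow> real"
    and \<Phi> :: "'c \<Rightarrow> 'b \<Rightarrow>\<^sub>L real" and K :: "'x \<Rightarrow> 'y \<Rightarrow> real"
    and J :: "'b \<Rightarrow> 'p::banach \<Rightarrow>\<^sub>L real" and \<nu> :: "'n::finite \<Rightarrow> 'p"
    and y0 :: "real^'n" and Q :: "real^'n \<Rightarrow> real^'n \<Rightarrow> real"
    and lam C :: real and \<phi> \<phi>' :: "real \<Rightarrow> real"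
    and zh :: "real^'n" and \<nu>h :: 'p
    and XF :: "'p \<Rightarrow> 'y set" and x' :: "nat \<Rightarrow> 'y"
    and N l :: nat and k :: "nat \<Rightarrow> nat" and \<alpha> \<alpha>h :: "nat \<Rightarrow> real"
  assumes pair: "rkbs_pair X ev X' ev' \<Phi> K"
    and predual: "predual J"
    and indep: "inj \<nu>" "independent (range \<nu>)"
    and lam: "lam > 0"
    and Q_nonneg: "\<forall>z. Q y0 z \<ge> 0"
    and Q_lsc: "lsc_on UNIV (Q y0)"
    and Q_convex: "convex_on UNIV (Q y0)"
    and phi_nonneg: "\<forall>t\<ge>0. \<phi> t \<ge> 0"
    and phi_lsc: "lsc_on {0..} \<phi>"
    and phi_coercive: "filterlim \<phi> at_top at_top"
    and phi_convex: "convex_on {0..} \<phi>"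
    and phi_deriv: "\<forall>t\<ge>0. (\<phi> has_real_derivative \<phi>' t) (at t within {0..})"
    and phi_mono: "strict_mono_on {0..} \<phi>"
    and zh: "zh \<in> measurement J \<nu> ` reg_solutions J \<nu> (Q y0) lam \<phi> - {0}"
    and nuh_span: "\<nu>h \<in> span (range \<nu>)"
    and nuh: "(\<lambda>f. norm \<nu>h *\<^sub>R f) ` predual_norm_subdiff J \<nu>h \<inter> interpolants J \<nu> zh \<noteq> {}"
    and A1: "assumption_A1 X ev X' K J (span (range \<nu>)) XF"
    and A2: "assumption_A2 X ev X' K C"
    and N: "N = card (XF \<nu>h)"
    and enum: "bij_betw x' {1..N} (XF \<nu>h)"
    and l: "l \<in> {1..N}"
    and k: "strict_mono_on {1..l} k" "k ` {1..l} \<subseteq> {1..N}"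
    and alpha_nz: "\<forall>i\<in>{1..l}. \<alpha> (k i) \<noteq> 0"
    and alphah: "\<alpha>h = (\<lambda>j. \<Sum>i=1..l. \<alpha> (k i) * unit_vec (k i) j)"
  shows "(\<Sum>i=1..l. \<alpha> (k i) *\<^sub>R kernel_section X ev K (x' (k i)))
           \<in> reg_solutions J \<nu> (Q y0) lam \<phi> \<longleftrightarrow>
         (\<exists>a \<in> subdifferential_vec (Q y0) (mat_vec N (kernel_matrix X ev K J \<nu> x') \<alpha>h).
            (\<forall>i\<in>{1..l}.
               lam = - (transpose_vec (kernel_matrix X ev K J \<nu> x') a (k i) * sgn (\<alpha> (k i)))
                       / (C * \<phi>' (C * l1_norm N \<alpha>h))) \<and>
            (\<forall>j\<in>{1..N} - k ` {1..l}.
               lam \<ge> \<bar>transpose_vec (kernel_matrix X ev K J \<nu> x') a j\<bar>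
                       / (C * \<phi>' (C * l1_norm N \<alpha>h))))"
proof -
  let ?M = "kernel_matrix X ev K J \<nu> x'"
  define I where "I = {1..N}"
  define \<kappa> where "\<kappa> j = kernel_section X ev K (x' j)" for j
  define f where "f = (\<Sum>j\<in>I. \<alpha>h j *\<^sub>R \<kappa> j)"
  define s where "s = C * l1_norm N \<alpha>h"
  define \<mu> where "\<mu> = lam * \<phi>' s * C"
  note lin_meas = linear_measurement[OF predual, of \<nu>]
  have mono: "mono_on {0..} \<phi>" using phi_mono by (rule strict_mono_on_imp_mono_on)

  obtain h where h: "h \<in> reg_solutions J \<nu> (Q y0) lam \<phi>" "measurement J \<nu> h = zh" "zh \<noteq> 0"
    using zh by auto
  obtain f0 where f0: "f0 \<in> predual_norm_subdiff J \<nu>h" "measurement J \<nu> (norm \<nu>h *\<^sub>R f0) = zh"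
    using nuh by (auto simp: interpolants_def)
  have "\<nu>h \<noteq> 0" using f0(2) h(3) linear_0[OF lin_meas] by auto
  then have XF: "XF \<nu>h \<subseteq> X'" and ext: "{g. g extreme_point_of predual_norm_subdiff J \<nu>h}
      \<subseteq> (\<Union>y\<in>XF \<nu>h. {- kernel_section X ev K y, kernel_section X ev K y})"
    using A1 nuh_span unfolding assumption_A1_def by blast+
  have img: "x' ` I = XF \<nu>h" and inj: "inj_on x' I"
    using enum by (auto simp: bij_betw_def I_def)
  have norm_sum: "norm (\<Sum>j\<in>I. \<beta> j *\<^sub>R \<kappa> j) = C * (\<Sum>j\<in>I. \<bar>\<beta> j\<bar>)" for \<beta>
    using A2 inj img XF unfolding assumption_A2_def I_def \<kappa>_def by blast
  have "C > 0" using A2 by (simp add: assumption_A2_def)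

  \<comment> \<open>Some solution is a combination of the sections indexed by \<open>I\<close>.\<close>
  obtain g where "g \<in> convex hull (\<Union>j\<in>I. {- \<kappa> j, \<kappa> j})"
    and g: "norm \<nu>h *\<^sub>R g \<in> reg_solutions J \<nu> (Q y0) lam \<phi>"
  proof (rule solution_in_hull_of_extreme_points[OF predual _ mono h(1) nuh_span f0(1)])
    show "{g. g extreme_point_of predual_norm_subdiff J \<nu>h} \<subseteq> (\<Union>j\<in>I. {- \<kappa> j, \<kappa> j})"
      using ext by (auto simp: \<kappa>_def simp flip: img)
  qed (use lam f0 h in \<open>auto simp: I_def\<close>)
  then obtain \<beta> where "g = (\<Sum>j\<in>I. \<beta> j *\<^sub>R \<kappa> j)"
    using convex_hull_signed_family[of I g \<kappa>] by (auto simp: I_def)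
  then have "norm \<nu>h *\<^sub>R g = (\<Sum>j\<in>I. (norm \<nu>h * \<beta> j) *\<^sub>R \<kappa> j)" by (simp add: scaleR_sum_right)
  then have sol: "(\<Sum>j\<in>I. (norm \<nu>h * \<beta> j) *\<^sub>R \<kappa> j) \<in> reg_solutions J \<nu> (Q y0) lam \<phi>"
    using g by simp

  \<comment> \<open>The candidate written over all of \<open>I\<close>, with zero coefficients off the chosen indices.\<close>
  have inj_k: "inj_on k {1..l}" using k(1) by (rule strict_mono_on_imp_inj_on)
  have \<alpha>h_k: "\<alpha>h (k i) = \<alpha> (k i)" if "i \<in> {1..l}" for i
  proof -
    have "\<alpha>h (k i) = (\<Sum>m=1..l. if m = i then \<alpha> (k m) else 0)"
      unfolding alphah using inj_k that
      by (intro sum.cong) (auto simp: unit_vec_def inj_on_eq_iff)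
    then show ?thesis using that by simp
  qed
  have \<alpha>h_0: "\<alpha>h j = 0" if "j \<notin> k ` {1..l}" for j
    unfolding alphah using that by (intro sum.neutral) (auto simp: unit_vec_def)
  have f_eq: "(\<Sum>i=1..l. \<alpha> (k i) *\<^sub>R kernel_section X ev K (x' (k i))) = f"
  proof -
    have "(\<Sum>i=1..l. \<alpha> (k i) *\<^sub>R \<kappa> (k i)) = (\<Sum>i=1..l. \<alpha>h (k i) *\<^sub>R \<kappa> (k i))"
      by (intro sum.cong) (auto simp: \<alpha>h_k)
    also have "\<dots> = (\<Sum>j\<in>k ` {1..l}. \<alpha>h j *\<^sub>R \<kappa> j)"
      using inj_k by (simp add: sum.reindex o_def)
    also have "\<dots> = f"
      unfolding f_def using k(2) by (intro sum.mono_neutral_left) (auto simp: I_def \<alpha>h_0)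
    finally show ?thesis by (simp add: \<kappa>_def)
  qed
  have meas_f: "measurement J \<nu> f = mat_vec N ?M \<alpha>h"
    unfolding f_def linear_sum[OF lin_meas] linear_cmul[OF lin_meas]
    by (simp add: vec_eq_iff mat_vec_def kernel_matrix_def measurement_def I_def \<kappa>_def mult.commute)
  have inner: "a \<bullet> measurement J \<nu> (\<kappa> j) = transpose_vec ?M a j" for a j
    by (simp add: inner_vec_def measurement_def transpose_vec_def kernel_matrix_def \<kappa>_def mult.commute)
  have norm_f: "norm f = s" using norm_sum[of \<alpha>h] unfolding f_def s_def l1_norm_def I_def .

  have one: "1 \<in> {1..l}" using l by simp
  then have "k 1 \<in> I" unfolding I_def using k(2) by blast
  moreover have "\<alpha>h (k 1) \<noteq> 0" using alpha_nz one \<alpha>h_k[OF one] by metis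
  ultimately have "0 < (\<Sum>j\<in>I. \<bar>\<alpha>h j\<bar>)" by (intro sum_pos2[of I "k 1"]) (auto simp: I_def)
  then have "s > 0" using \<open>C > 0\<close> by (simp add: s_def l1_norm_def I_def)
  then have D: "(\<phi> has_real_derivative \<phi>' s) (at s within {0..})" using phi_deriv by simp
  have "\<phi>' s > 0" using strict_mono_convex_derivative_pos[OF phi_convex phi_mono D \<open>s > 0\<close>] .
  then have den: "C * \<phi>' s > 0" using \<open>C > 0\<close> by simp

  have "f \<in> reg_solutions J \<nu> (Q y0) lam \<phi> \<longleftrightarrow>
    (\<forall>v. Q y0 (measurement J \<nu> f) + lam * \<phi> (norm f) \<le> Q y0 (measurement J \<nu> v) + lam * \<phi> (norm v))"
    by (simp add: reg_solutions_def reg_objective_def)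
  also have "\<dots> \<longleftrightarrow> (\<exists>a. (\<forall>z. Q y0 (measurement J \<nu> f) + a \<bullet> (z - measurement J \<nu> f) \<le> Q y0 z) \<and>
      (\<forall>j\<in>I. (\<alpha>h j \<noteq> 0 \<longrightarrow> a \<bullet> measurement J \<nu> (\<kappa> j) * sgn (\<alpha>h j) = - \<mu>) \<and>
              (\<alpha>h j = 0 \<longrightarrow> \<bar>a \<bullet> measurement J \<nu> (\<kappa> j)\<bar> \<le> \<mu>)))"
    unfolding f_def \<mu>_def
  proof (rule minimiser_iff_multiplier[OF _ lin_meas Q_convex norm_sum _ _ mono phi_convex])
    show "(\<phi> has_real_derivative \<phi>' s) (at (norm (\<Sum>j\<in>I. \<alpha>h j *\<^sub>R \<kappa> j)) within {0..})"
      using D norm_f by (simp add: f_def)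
    show "(\<Sum>j\<in>I. \<alpha>h j *\<^sub>R \<kappa> j) \<noteq> 0" using norm_f \<open>s > 0\<close> by (auto simp: f_def)
    show "Q y0 (measurement J \<nu> (\<Sum>j\<in>I. (norm \<nu>h * \<beta> j) *\<^sub>R \<kappa> j))
          + lam * \<phi> (norm (\<Sum>j\<in>I. (norm \<nu>h * \<beta> j) *\<^sub>R \<kappa> j))
        \<le> Q y0 (measurement J \<nu> v) + lam * \<phi> (norm v)" for v
      using sol unfolding reg_solutions_def reg_objective_def by blast
  qed (use lam \<open>C > 0\<close> \<open>\<phi>' s > 0\<close> in \<open>auto simp: I_def\<close>)
  also have "\<dots> \<longleftrightarrow> (\<exists>a \<in> subdifferential_vec (Q y0) (mat_vec N ?M \<alpha>h).
      (\<forall>j\<in>I. (\<alpha>h j \<noteq> 0 \<longrightarrow> transpose_vec ?M a j * sgn (\<alpha>h j) = - \<mu>) \<and>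
              (\<alpha>h j = 0 \<longrightarrow> \<bar>transpose_vec ?M a j\<bar> \<le> \<mu>)))"
    by (auto simp: subdifferential_vec_iff meas_f inner Bex_def)
  also have "\<dots> \<longleftrightarrow> (\<exists>a \<in> subdifferential_vec (Q y0) (mat_vec N ?M \<alpha>h).
      (\<forall>i\<in>{1..l}. lam = - (transpose_vec ?M a (k i) * sgn (\<alpha> (k i))) / (C * \<phi>' s)) \<and>
      (\<forall>j\<in>I - k ` {1..l}. lam \<ge> \<bar>transpose_vec ?M a j\<bar> / (C * \<phi>' s)))"
  proof (rule bex_cong[OF refl])
    fix a
    have "(\<forall>j\<in>I. (\<alpha>h j \<noteq> 0 \<longrightarrow> transpose_vec ?M a j * sgn (\<alpha>h j) = - \<mu>) \<and>
              (\<alpha>h j = 0 \<longrightarrow> \<bar>transpose_vec ?M a j\<bar> \<le> \<mu>)) \<longleftrightarrow>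
      (\<forall>i\<in>{1..l}. transpose_vec ?M a (k i) * sgn (\<alpha> (k i)) = - \<mu>) \<and>
      (\<forall>j\<in>I - k ` {1..l}. \<bar>transpose_vec ?M a j\<bar> \<le> \<mu>)" (is "?L \<longleftrightarrow> ?R")
    proof
      assume ?L
      then show ?R using k(2) alpha_nz \<alpha>h_k \<alpha>h_0 unfolding I_def by fastforce
    next
      assume R: ?R
      show ?L
      proof
        fix j assume "j \<in> I"
        show "(\<alpha>h j \<noteq> 0 \<longrightarrow> transpose_vec ?M a j * sgn (\<alpha>h j) = - \<mu>) \<and>
              (\<alpha>h j = 0 \<longrightarrow> \<bar>transpose_vec ?M a j\<bar> \<le> \<mu>)"
        proof (cases "j \<in> k ` {1..l}")
          case True
          then show ?thesis using R alpha_nz \<alpha>h_k by auto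
        next
          case False
          then show ?thesis using R \<alpha>h_0 \<open>j \<in> I\<close> by auto
        qed
      qed
    qed
    moreover have "t = - \<mu> \<longleftrightarrow> lam = - t / (C * \<phi>' s)" "r \<le> \<mu> \<longleftrightarrow> r / (C * \<phi>' s) \<le> lam" for t r
    proof -
      have *: "(t = - (lam * q) \<longleftrightarrow> lam = - t / q) \<and> (r \<le> lam * q \<longleftrightarrow> r / q \<le> lam)" if "q > 0" for q
        using that by (auto simp: field_simps)
      have "\<mu> = lam * (C * \<phi>' s)" by (simp add: \<mu>_def mult_ac)
      then show "t = - \<mu> \<longleftrightarrow> lam = - t / (C * \<phi>' s)" "r \<le> \<mu> \<longleftrightarrow> r / (C * \<phi>' s) \<le> lam"
        using *[OF den] by simp_all
    qed
    ultimately show "(\<forall>j\<in>I. (\<alpha>h j \<noteq> 0 \<longrightarrow> transpose_vec ?M a j * sgn (\<alpha>h j) = - \<mu>) \<and>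
              (\<alpha>h j = 0 \<longrightarrow> \<bar>transpose_vec ?M a j\<bar> \<le> \<mu>)) \<longleftrightarrow>
      (\<forall>i\<in>{1..l}. lam = - (transpose_vec ?M a (k i) * sgn (\<alpha> (k i))) / (C * \<phi>' s)) \<and>
      (\<forall>j\<in>I - k ` {1..l}. lam \<ge> \<bar>transpose_vec ?M a j\<bar> / (C * \<phi>' s))"
      by simp
  qed
  finally show ?thesis by (simp only: f_eq s_def I_def)
qed

end
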